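(* For every integer $n\ge4$, $\Xi_n\subseteq\Theta_{n-1}$; that is, every complex number that is an eigenvalue of some $n\times n$ monotone matrix is also an eigenvalue of some $(n-1)\times(n-1)$ stochastic matrix.
   Context: A stochastic matrix is a (real) entrywise non-negative square matrix each of whose row sums equals $1$. An $n\times n$ monotone matrix is an $n\times n$ stochastic matrix $M=(m_{ij})$ such that $\sum_{j=r}^n m_{lj}\ge\sum_{j=r}^n m_{kj}$ for all $l>k$ in $\{1,\dots,n\}$ and all $r\in\{1,\dots,n\}$. Define $\Xi_n:=\{\lambda\in\mathbb{C}:\lambda\text{ is an eigenvalue of some } n\times n\text{ monotone matrix}\}$ and $\Theta_n:=\{\lambda\in\mathbb{C}:\lambda\text{ is an eigenvalue of some } n\times n\text{ stochastic matrix}\}$. *)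

theory Defs
  imports Complex_Main "Jordan_Normal_Form.Char_Poly"
begin

text \<open>
  Matrices are indexed from 0 (as in \<^theory>\<open>Jordan_Normal_Form.Matrix\<close>), so the index set
  \<open>{1, \<dots>, n}\<close> of rows and columns becomes \<open>{0, \<dots>, n - 1}\<close>.
\<close>

definition stochastic_mat :: "nat \<Rightarrow> real mat \<Rightarrow> bool" where
  "stochastic_mat n M \<longleftrightarrow>
     M \<in> carrier_mat n n \<and>
     (\<forall>i<n. \<forall>j<n. 0 \<le> M $$ (i, j)) \<and>
     (\<forall>i<n. (\<Sum>j = 0..<n. M $$ (i, j)) = 1)"

definition monotone_mat :: "nat \<Rightarrow> real mat \<Rightarrow> bool" where
  "monotone_mat n M \<longleftrightarrow>
     stochastic_mat n M \<and>
     (\<forall>k<n. \<forall>l<n. \<forall>r<n. k < l \<longrightarrow>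
        (\<Sum>j = r..<n. M $$ (k, j)) \<le> (\<Sum>j = r..<n. M $$ (l, j)))"

definition Xi :: "nat \<Rightarrow> complex set" where
  "Xi n = {z. \<exists>M. monotone_mat n M \<and> eigenvalue (map_mat complex_of_real M) z}"

definition Theta :: "nat \<Rightarrow> complex set" where
  "Theta n = {z. \<exists>M. stochastic_mat n M \<and> eigenvalue (map_mat complex_of_real M) z}"

end

theory Submission
  imports "HOL-Analysis.Convex_Euclidean_Space" Defs
begin


text \<open>Put \<open>m = n - 1\<close>. A monotone matrix acts on the span of the indicator
  vectors of final segments; the full indicator is fixed because rows sum to 1. Modulo that vector
  the action is given by differences of tail sums of consecutive rows: monotonicity makes them
  nonnegative, and telescoping bounds their total by 1. So every eigenvalue other than 1 belongs to
  a substochastic matrix of size \<open>m\<close> (\<open>monotone_eigenvalue_in_Theta\<close>).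

  It remains to pass from substochastic to stochastic
  (\<open>substochastic_eigenvalue_in_Theta\<close>). If 0 is a convex combination of the entries of
  an eigenvector, the combination's weights can fill up the rows without disturbing the eigenvector.
  Otherwise the entries lie in an open half plane, which forces the eigenvalue into the real
  interval from 0 to 1 (\<open>substochastic_eigenvalue_half_plane\<close>), and these numbers are
  realised directly.\<close>

lemma eigenvalue_real_mat_iff:
  fixes A :: "real mat" and \<mu> :: complex
  assumes "A \<in> carrier_mat m m"
  shows "eigenvalue (map_mat complex_of_real A) \<mu> \<longleftrightarrow>
    (\<exists>x. (\<exists>i<m. x i \<noteq> 0) \<and> (\<forall>i<m. (\<Sum>j<m. of_real (A $$ (i, j)) * x j) = \<mu> * x i))"
    (is "?L \<longleftrightarrow> ?R")
proof
  assume ?L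
  then obtain v where v: "v \<in> carrier_vec m" "v \<noteq> 0\<^sub>v m"
      "map_mat complex_of_real A *\<^sub>v v = \<mu> \<cdot>\<^sub>v v"
    using assms unfolding eigenvalue_def eigenvector_def by auto
  have "\<exists>i<m. v $ i \<noteq> 0"
    using v(1,2) by auto
  moreover have "(\<Sum>j<m. of_real (A $$ (i, j)) * v $ j) = \<mu> * v $ i" if "i < m" for i
  proof -
    have "(map_mat complex_of_real A *\<^sub>v v) $ i = (\<mu> \<cdot>\<^sub>v v) $ i"
      using v(3) by simp
    then show ?thesis
      using that v(1) assms by (simp add: scalar_prod_def lessThan_atLeast0)
  qed
  ultimately show ?R by (intro exI[of _ "\<lambda>i. v $ i"]) auto
next
  assume ?R
  then obtain x where x: "\<exists>i<m. x i \<noteq> 0"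
      "\<And>i. i < m \<Longrightarrow> (\<Sum>j<m. of_real (A $$ (i, j)) * x j) = \<mu> * x i"
    by blast
  have "vec m x \<noteq> 0\<^sub>v m"
    using x(1) by (auto simp: vec_eq_iff)
  moreover have "map_mat complex_of_real A *\<^sub>v vec m x = \<mu> \<cdot>\<^sub>v vec m x"
    using assms x(2) by (intro eq_vecI) (auto simp: scalar_prod_def lessThan_atLeast0)
  ultimately show ?L
    using assms unfolding eigenvalue_def eigenvector_def by (intro exI[of _ "vec m x"]) auto
qed

lemma eigenvalue_transpose:
  fixes A :: "'a :: field mat"
  assumes "A \<in> carrier_mat n n"
  shows "eigenvalue (transpose_mat A) \<mu> \<longleftrightarrow> eigenvalue A \<mu>"
  using assms by (simp add: eigenvalue_root_char_poly[of _ n])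

lemma of_real_unit_interval_in_Theta:
  assumes m: "2 \<le> m" and p: "0 \<le> p" "p \<le> 1"
  shows "complex_of_real p \<in> Theta m"
proof -
  \<comment> \<open>\<open>A\<close> is \<open>p\<close> times the identity plus
    \<open>1 - p\<close> times the uniform averaging matrix. Averaging kills \<open>x\<close>, the
    difference of the first two unit vectors, since its entries sum to 0; two coordinates are needed
    for this.\<close>
  define A where "A = mat m m (\<lambda>(i, j). (if i = j then p else 0) + (1 - p) / real m)"
  define x :: "nat \<Rightarrow> complex" where "x = (\<lambda>i. (if i = 0 then 1 else 0) - (if i = 1 then 1 else 0))"
  have A: "A \<in> carrier_mat m m" and A_eq:
    "\<And>i j. i < m \<Longrightarrow> j < m \<Longrightarrow> A $$ (i, j) = (if i = j then p else 0) + (1 - p) / real m"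
    by (simp_all add: A_def)
  have "stochastic_mat m A"
    unfolding stochastic_mat_def using A A_eq m p
    by (auto simp: sum.distrib)
  moreover have "(\<Sum>j<m. of_real (A $$ (i, j)) * x j) = of_real p * x i" if i: "i < m" for i
  proof -
    have sx: "(\<Sum>j<m. x j) = 0"
      using m by (simp add: x_def sum_subtractf)
    have "(\<Sum>j<m. of_real (A $$ (i, j)) * x j) =
        (\<Sum>j<m. (if i = j then of_real p * x j else 0) + of_real ((1 - p) / real m) * x j)"
      using i by (intro sum.cong) (auto simp: A_eq algebra_simps)
    also have "\<dots> = of_real p * x i + of_real ((1 - p) / real m) * (\<Sum>j<m. x j)"
      using i by (simp only: sum.distrib sum_distrib_left) simp
    finally show ?thesis using sx by simp
  qed
  moreover have "\<exists>i<m. x i \<noteq> 0"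
    using m by (intro exI[of _ 0]) (auto simp: x_def)
  ultimately show ?thesis
    unfolding Theta_def using eigenvalue_real_mat_iff[OF A] by blast
qed

section \<open>From substochastic to stochastic matrices\<close>

text \<open>Moves convex weights from values to indices: the hull of the image set does not see
  repeated entries of \<open>x\<close>, but the rows of a matrix are indexed by positions.\<close>

lemma zero_in_convex_hull_image:
  fixes x :: "nat \<Rightarrow> 'a :: real_vector"
  assumes "0 \<in> convex hull (x ` {..<m})"
  obtains v where "\<And>i. 0 \<le> v i" "(\<Sum>i<m. v i) = 1" "(\<Sum>i<m. v i *\<^sub>R x i) = 0"
proof -
  obtain u where u: "\<And>y. y \<in> x ` {..<m} \<Longrightarrow> 0 \<le> u y" "sum u (x ` {..<m}) = 1"
      "(\<Sum>y\<in>x ` {..<m}. u y *\<^sub>R y) = 0"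
    using assms by (auto simp: convex_hull_finite)
  \<comment> \<open>\<open>T\<close> picks one index for each value of \<open>x\<close>; that index
    carries the whole weight of the value, and all other indices get 0.\<close>
  define T where "T = inv_into {..<m} x ` (x ` {..<m})"
  have T: "T \<subseteq> {..<m}"
    by (auto simp: T_def intro: inv_into_into[of _ x "{..<m}", simplified])
  have bij: "bij_betw x T (x ` {..<m})"
    unfolding T_def bij_betw_def inj_on_def by (auto simp: f_inv_into_f image_image)
  have TI: "{..<m} \<inter> T = T" using T by auto
  define v where "v i = (if i \<in> T then u (x i) else 0)" for i
  show ?thesis
  proof
    show "0 \<le> v i" for i using u(1) T by (auto simp: v_def)
    show "(\<Sum>i<m. v i) = 1"
      using sum.reindex_bij_betw[OF bij, of u] u(2)
      by (simp add: v_def TI flip: sum.inter_restrict)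
    have "(\<Sum>i<m. v i *\<^sub>R x i) = (\<Sum>i<m. if i \<in> T then u (x i) *\<^sub>R x i else 0)"
      by (intro sum.cong) (auto simp: v_def)
    then show "(\<Sum>i<m. v i *\<^sub>R x i) = 0"
      using sum.reindex_bij_betw[OF bij, of "\<lambda>y. u y *\<^sub>R y"] u(3)
      by (simp add: TI flip: sum.inter_restrict)
  qed
qed

text \<open>
  The numbers \<open>y i\<close> span a sector of angle less than \<open>\<pi>\<close> that is mapped into itself by
  multiplication with \<open>\<mu>\<close>. The extreme slopes \<open>Im (y i) / Re (y i)\<close> force \<open>Im \<mu> = 0\<close>, and
  the largest real part bounds \<open>\<mu>\<close> by 1.
\<close>
lemma substochastic_eigenvalue_half_plane:
  fixes A :: "nat \<Rightarrow> nat \<Rightarrow> real" and y :: "nat \<Rightarrow> complex"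
  assumes m: "0 < m"
    and nonneg: "\<And>i j. i < m \<Longrightarrow> j < m \<Longrightarrow> 0 \<le> A i j"
    and rows: "\<And>i. i < m \<Longrightarrow> (\<Sum>j<m. A i j) \<le> 1"
    and ev: "\<And>i. i < m \<Longrightarrow> (\<Sum>j<m. of_real (A i j) * y j) = \<mu> * y i"
    and pos: "\<And>i. i < m \<Longrightarrow> 0 < Re (y i)"
  shows "Im \<mu> = 0" "0 \<le> Re \<mu>" "Re \<mu> \<le> 1"
proof -
  have re: "(\<Sum>j<m. A i j * Re (y j)) = Re \<mu> * Re (y i) - Im \<mu> * Im (y i)"
    and im: "(\<Sum>j<m. A i j * Im (y j)) = Re \<mu> * Im (y i) + Im \<mu> * Re (y i)" if "i < m" for i
    using arg_cong[OF ev[OF that], of Re] arg_cong[OF ev[OF that], of Im] by simp_all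
  define t where "t i = Im (y i) / Re (y i)" for i
  have t: "Im (y i) = t i * Re (y i)" if "i < m" for i
    using pos[OF that] by (simp add: t_def)
  \<comment> \<open>The sign of \<open>s\<close> selects the extreme: \<open>s = 1\<close> tests the
    largest slope, \<open>s = -1\<close> the smallest. A nonnegative combination of the
    \<open>y j\<close> cannot have a slope beyond the extreme one, so \<mu> cannot rotate
    \<open>y i\<close> outwards.\<close>
  have key: "s * Im \<mu> \<le> 0" if i: "i < m" and s: "\<And>j. j < m \<Longrightarrow> s * t j \<le> s * t i" for i s
  proof -
    have "(\<Sum>j<m. A i j * (s * Im (y j))) \<le> (\<Sum>j<m. A i j * (s * t i * Re (y j)))"
    proof (intro sum_mono mult_left_mono)
      fix j assume "j \<in> {..<m}"
      then show "s * Im (y j) \<le> s * t i * Re (y j)"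
        using s[of j] t[of j] pos[of j] mult_right_mono[of "s * t j" "s * t i" "Re (y j)"]
        by (simp add: algebra_simps)
    qed (use nonneg i in auto)
    then have "s * (\<Sum>j<m. A i j * Im (y j)) \<le> s * t i * (\<Sum>j<m. A i j * Re (y j))"
      by (simp add: sum_distrib_left mult_ac)
    then have "s * (Re \<mu> * (t i * Re (y i)) + Im \<mu> * Re (y i))
        \<le> s * t i * (Re \<mu> * Re (y i) - Im \<mu> * (t i * Re (y i)))"
      using re[OF i] im[OF i] t[OF i] by simp
    \<comment> \<open>The terms with \<open>Re \<mu>\<close> cancel; what remains is
      \<open>Im \<mu>\<close> times a positive factor.\<close>
    then have "(s * Im \<mu>) * (Re (y i) * (1 + (t i)\<^sup>2)) \<le> 0"
      by (simp add: algebra_simps power2_eq_square)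
    moreover have "0 < Re (y i) * (1 + (t i)\<^sup>2)"
      using pos[OF i] by (intro mult_pos_pos) (auto intro: add_pos_nonneg)
    ultimately show ?thesis
      using mult_pos_pos by (meson not_le)
  qed
  have ex_max: "\<exists>i<m. \<forall>j<m. f j \<le> f i" for f :: "nat \<Rightarrow> real"
  proof -
    have "finite (f ` {..<m})" "f ` {..<m} \<noteq> {}" using m by auto
    then have "Max (f ` {..<m}) \<in> f ` {..<m}" "\<forall>j<m. f j \<le> Max (f ` {..<m})"
      using Max_in by auto
    then show ?thesis by (metis imageE lessThan_iff)
  qed
  have "s * Im \<mu> \<le> 0" for s
    using ex_max[of "\<lambda>i. s * t i"] key[of _ s] by blast
  from this[of 1] this[of "-1"] show Im0: "Im \<mu> = 0" by simp
  obtain i where i: "i < m" "\<And>j. j < m \<Longrightarrow> Re (y j) \<le> Re (y i)"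
    using ex_max[of "\<lambda>i. Re (y i)"] by blast
  have eq: "(\<Sum>j<m. A i j * Re (y j)) = Re \<mu> * Re (y i)"
    using re[OF i(1)] Im0 by simp
  have "0 \<le> Re \<mu> * Re (y i)"
    unfolding eq[symmetric] using i(1) nonneg pos
    by (intro sum_nonneg mult_nonneg_nonneg) (auto intro: less_imp_le)
  then show "0 \<le> Re \<mu>"
    using pos[OF i(1)] by (simp add: zero_le_mult_iff)
  have "Re \<mu> * Re (y i) \<le> (\<Sum>j<m. A i j * Re (y i))"
    unfolding eq[symmetric] using i nonneg by (intro sum_mono mult_left_mono) auto
  also have "\<dots> \<le> 1 * Re (y i)"
    unfolding sum_distrib_right[symmetric] using rows[OF i(1)] pos[OF i(1)]
    by (intro mult_right_mono) auto
  finally show "Re \<mu> \<le> 1" using pos[OF i(1)] by simp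
qed

text \<open>Everything hinges on whether 0 lies in the convex hull of the eigenvector's entries: if
  so, the matrix can be completed to a stochastic one with the same eigenvector; if not, separation
  from 0 reduces to the half-plane case.\<close>

lemma substochastic_eigenvalue_in_Theta:
  fixes A :: "nat \<Rightarrow> nat \<Rightarrow> real" and x :: "nat \<Rightarrow> complex"
  assumes m: "2 \<le> m"
    and nonneg: "\<And>i j. i < m \<Longrightarrow> j < m \<Longrightarrow> 0 \<le> A i j"
    and rows: "\<And>i. i < m \<Longrightarrow> (\<Sum>j<m. A i j) \<le> 1"
    and ev: "\<And>i. i < m \<Longrightarrow> (\<Sum>j<m. of_real (A i j) * x j) = \<mu> * x i"
    and nz: "\<exists>i<m. x i \<noteq> 0"
  shows "\<mu> \<in> Theta m"
proof (cases "0 \<in> convex hull (x ` {..<m})")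
  case True
  then obtain v where v: "\<And>i. 0 \<le> v i" "(\<Sum>i<m. v i) = 1" "(\<Sum>i<m. v i *\<^sub>R x i) = 0"
    by (rule zero_in_convex_hull_image) blast
  \<comment> \<open>Distributing the row deficits according to \<open>v\<close> does not change the action on \<open>x\<close>.\<close>
  define d where "d i = 1 - (\<Sum>j<m. A i j)" for i
  define B where "B = mat m m (\<lambda>(i, j). A i j + d i * v j)"
  have B: "B \<in> carrier_mat m m"
    and B_eq: "\<And>i j. i < m \<Longrightarrow> j < m \<Longrightarrow> B $$ (i, j) = A i j + d i * v j"
    by (simp_all add: B_def)
  have d: "0 \<le> d i" if "i < m" for i
    using rows[OF that] by (simp add: d_def)
  have "stochastic_mat m B"
    unfolding stochastic_mat_def
  proof (intro conjI allI impI)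
    show "0 \<le> B $$ (i, j)" if "i < m" "j < m" for i j
      using that nonneg d v(1) by (simp add: B_eq)
    show "(\<Sum>j = 0..<m. B $$ (i, j)) = 1" if "i < m" for i
    proof -
      have "(\<Sum>j<m. B $$ (i, j)) = (\<Sum>j<m. A i j) + d i * (\<Sum>j<m. v j)"
        using that by (simp add: B_eq sum.distrib sum_distrib_left)
      then show ?thesis
        using v(2) by (simp add: d_def lessThan_atLeast0)
    qed
  qed (rule B)
  moreover have "(\<Sum>j<m. of_real (B $$ (i, j)) * x j) = \<mu> * x i" if i: "i < m" for i
  proof -
    have "(\<Sum>j<m. of_real (B $$ (i, j)) * x j) =
        (\<Sum>j<m. of_real (A i j) * x j) + of_real (d i) * (\<Sum>j<m. v j *\<^sub>R x j)"
      using i by (simp add: B_eq sum.distrib sum_distrib_left scaleR_conv_of_real algebra_simps)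
    then show ?thesis using v(3) ev[OF i] by simp
  qed
  ultimately show ?thesis
    unfolding Theta_def using eigenvalue_real_mat_iff[OF B] nz by blast
next
  case False
  \<comment> \<open>Strict separation of 0 from the compact hull gives a direction \<open>a\<close>;
    multiplying the eigenvector by \<open>cnj a\<close> turns the separating half plane into the
    right one and preserves the eigenvalue equation.\<close>
  have "closed (convex hull (x ` {..<m}))"
    by (simp add: compact_imp_closed finite_imp_compact_convex_hull)
  then obtain a b where ab: "0 < b" "\<forall>z\<in>convex hull (x ` {..<m}). b < inner a z"
    using separating_hyperplane_closed_0[OF convex_convex_hull _ False] by blast
  have pos: "0 < Re (cnj a * x i)" if "i < m" for i
  proof -
    have "x i \<in> convex hull (x ` {..<m})" using that by (intro hull_inc) auto
    then have "b < inner a (x i)" using ab(2) by blast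
    then show ?thesis using ab(1) by (simp add: inner_complex_def)
  qed
  have ev': "(\<Sum>j<m. of_real (A i j) * (cnj a * x j)) = \<mu> * (cnj a * x i)" if "i < m" for i
    using arg_cong[OF ev[OF that], of "\<lambda>z. cnj a * z"] by (simp add: sum_distrib_left mult_ac)
  have "0 < m" using m by simp
  note half_plane = substochastic_eigenvalue_half_plane[OF this nonneg rows ev' pos]
  have "\<mu> = of_real (Re \<mu>)" using half_plane(1) by (simp add: complex_eq_iff)
  then show ?thesis
    using of_real_unit_interval_in_Theta[OF m half_plane(2,3)] by metis
qed

section \<open>Reduction of monotone matrices to substochastic ones\<close>

text \<open>Summation by parts: each \<open>w j\<close> is counted with the increments of
  \<open>f\<close> up to \<open>j\<close>, which telescope.\<close>

lemma sum_diff_mult_tail_sum: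
  fixes f w :: "nat \<Rightarrow> 'a :: comm_ring"
  shows "(\<Sum>k<m. (f (Suc k) - f k) * (\<Sum>j = Suc k..<Suc m. w j)) = (\<Sum>j<Suc m. w j * (f j - f 0))"
proof (induction m)
  case (Suc m)
  have "(\<Sum>k<Suc m. (f (Suc k) - f k) * (\<Sum>j = Suc k..<Suc (Suc m). w j)) =
      (\<Sum>k<Suc m. (f (Suc k) - f k) * ((\<Sum>j = Suc k..<Suc m. w j) + w (Suc m)))"
    by (intro sum.cong refl arg_cong2[where f = "(*)"] sum.atLeastLessThan_Suc) simp
  also have "\<dots> =
      (\<Sum>k<Suc m. (f (Suc k) - f k) * (\<Sum>j = Suc k..<Suc m. w j)) +
      (\<Sum>k<Suc m. (f (Suc k) - f k)) * w (Suc m)"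
    by (simp only: distrib_left sum.distrib sum_distrib_right)
  also have "\<dots> = (\<Sum>j<Suc m. w j * (f j - f 0)) + (f (Suc m) - f 0) * w (Suc m)"
    using Suc.IH by (simp add: sum_lessThan_telescope del: sum.lessThan_Suc) simp
  finally show ?case by (simp add: mult.commute)
qed simp

text \<open>
  In the basis of the indicator vectors of the final segments \<open>{r..<n}\<close> a monotone matrix is
  block triangular with a block 1 and a nonnegative block whose column sums telescope to
  differences of tail sums of the rows, hence are at most 1. The tail sums of a left eigenvector
  therefore form an eigenvector of the transposed, substochastic, block.
\<close>
lemma monotone_eigenvalue_in_Theta:
  assumes m: "2 \<le> m" and M: "monotone_mat (Suc m) M"
    and ev: "eigenvalue (map_mat complex_of_real M) \<mu>"
  shows "\<mu> \<in> Theta m"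
proof (cases "\<mu> = 1")
  case True
  then show ?thesis using of_real_unit_interval_in_Theta[OF m, of 1] by simp
next
  case False
  let ?n = "Suc m"
  have carr: "M \<in> carrier_mat ?n ?n"
    and Mnn: "\<And>i j. i < ?n \<Longrightarrow> j < ?n \<Longrightarrow> 0 \<le> M $$ (i, j)"
    and Mrow: "\<And>i. i < ?n \<Longrightarrow> (\<Sum>j<?n. M $$ (i, j)) = 1"
    using M by (auto simp: monotone_mat_def stochastic_mat_def lessThan_atLeast0)
  define S where "S i r = (\<Sum>j = r..<?n. M $$ (i, j))" for i r
  have S_mono: "S k r \<le> S l r" if "k < l" "l < ?n" "r < ?n" for k l r
    using M that unfolding monotone_mat_def S_def by auto
  have S_le: "S m r \<le> 1" for r
  proof -
    have "S m r \<le> (\<Sum>j<?n. M $$ (m, j))"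
      unfolding S_def using Mnn by (intro sum_mono2) auto
    then show ?thesis using Mrow by simp
  qed
  have S_nonneg: "0 \<le> S 0 r" for r
    unfolding S_def using Mnn by (intro sum_nonneg) auto
  have "eigenvalue (map_mat complex_of_real (transpose_mat M)) \<mu>"
    using ev carr eigenvalue_transpose[of "map_mat complex_of_real M" ?n \<mu>]
    by (simp add: map_mat_transpose)
  then obtain w where w: "\<exists>i<?n. w i \<noteq> 0"
    and w_ev': "\<forall>j<?n. (\<Sum>i<?n. of_real (transpose_mat M $$ (j, i)) * w i) = \<mu> * w j"
    using eigenvalue_real_mat_iff[of "transpose_mat M" ?n \<mu>] carr by auto
  have w_ev: "(\<Sum>i<?n. of_real (M $$ (i, j)) * w i) = \<mu> * w j" if "j < ?n" for j
    using w_ev'[rule_format, OF that] that carr by (simp del: sum.lessThan_Suc cong: sum.cong_simp)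
  \<comment> \<open>\<open>S i r\<close> is entry \<open>i\<close> of \<open>M\<close> applied to
    the indicator of the final segment from \<open>r\<close>; pairing it with the left eigenvector
    \<open>w\<close> gives \<mu> times a tail sum of \<open>w\<close>.\<close>
  have tail: "\<mu> * (\<Sum>j = r..<?n. w j) = (\<Sum>i<?n. w i * of_real (S i r))" for r
  proof -
    have "\<mu> * (\<Sum>j = r..<?n. w j) = (\<Sum>j = r..<?n. \<Sum>i<?n. of_real (M $$ (i, j)) * w i)"
      unfolding sum_distrib_left by (intro sum.cong) (use w_ev in auto)
    also have "\<dots> = (\<Sum>i<?n. \<Sum>j = r..<?n. of_real (M $$ (i, j)) * w i)"
      by (rule sum.swap)
    finally show ?thesis
      by (simp add: S_def sum_distrib_left mult.commute del: sum.lessThan_Suc sum.op_ivl_Suc)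
  qed
  \<comment> \<open>At \<open>r = 0\<close> every \<open>S i 0\<close> is 1, so \<mu> fixes the
    total of \<open>w\<close>; as \<mu> is not 1, the total vanishes. This removes the
    \<open>f 0\<close> term in the summation by parts.\<close>
  have "\<mu> * (\<Sum>j<?n. w j) = (\<Sum>i<?n. w i * of_real (S i 0))"
    using tail[of 0] by (simp only: lessThan_atLeast0)
  also have "\<dots> = (\<Sum>i<?n. w i)"
    using Mrow by (intro sum.cong) (auto simp: S_def lessThan_atLeast0 simp del: sum.op_ivl_Suc)
  finally have sum_w: "(\<Sum>j<?n. w j) = 0"
    using False by (simp del: sum.lessThan_Suc)
  \<comment> \<open>The shift to \<open>Suc r\<close> drops the vanishing tail sum at 0, leaving
    \<open>m\<close> coordinates.\<close>
  define z where "z r = (\<Sum>j = Suc r..<?n. w j)" for r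
  define A where "A r k = S (Suc k) (Suc r) - S k (Suc r)" for r k
  show ?thesis
  proof (rule substochastic_eigenvalue_in_Theta[where A = A and x = z])
    show "2 \<le> m" by (rule m)
    show "0 \<le> A i j" if "i < m" "j < m" for i j
      using S_mono[of j "Suc j" "Suc i"] that by (simp add: A_def)
    show "(\<Sum>j<m. A i j) \<le> 1" for i
      unfolding A_def using S_le[of "Suc i"] S_nonneg[of "Suc i"]
      by (simp add: sum_lessThan_telescope[where f = "\<lambda>k. S k (Suc i)"])
    show "(\<Sum>j<m. of_real (A i j) * z j) = \<mu> * z i" for i
    proof -
      let ?f = "\<lambda>k. complex_of_real (S k (Suc i))"
      have "(\<Sum>j<m. of_real (A i j) * z j) = (\<Sum>j<?n. w j * (?f j - ?f 0))"
        unfolding A_def z_def of_real_diff by (rule sum_diff_mult_tail_sum)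
      also have "\<dots> = (\<Sum>j<?n. w j * ?f j) - (\<Sum>j<?n. w j) * ?f 0"
        by (simp only: right_diff_distrib sum_subtractf sum_distrib_right)
      finally show ?thesis
        using tail[of "Suc i"] sum_w by (simp add: z_def del: sum.lessThan_Suc)
    qed
    show "\<exists>i<m. z i \<noteq> 0"
    proof (rule ccontr)
      assume "\<not> ?thesis"
      then have z0: "z i = 0" if "i < m" for i using that by blast
      \<comment> \<open>Each \<open>w i\<close> is the difference of two consecutive tail sums, so
        if all of them vanish, including the empty one at \<open>?n\<close>, then so does
        \<open>w\<close>.\<close>
      have tail0: "(\<Sum>j = r..<?n. w j) = 0" if "r \<le> ?n" for r
      proof (cases r)
        case 0
        then show ?thesis using sum_w by (simp only: lessThan_atLeast0)
      next
        case (Suc i)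
        then show ?thesis using z0[of i] that by (cases "i < m") (auto simp: z_def)
      qed
      have "w i = 0" if "i < ?n" for i
        using tail0[of i] tail0[of "Suc i"] that sum.atLeast_Suc_lessThan[of i ?n w] by simp
      with w show False by blast
    qed
  qed
qed

theorem theorem5p2:
  fixes n :: nat
  assumes "n \<ge> 4"
  shows "Xi n \<subseteq> Theta (n - 1)"
proof
  fix \<mu> assume "\<mu> \<in> Xi n"
  then obtain M where "monotone_mat n M" "eigenvalue (map_mat complex_of_real M) \<mu>"
    by (auto simp: Xi_def)
  then show "\<mu> \<in> Theta (n - 1)"
    using monotone_eigenvalue_in_Theta[of "n - 1" M \<mu>] assms by simp
qed

end
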